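(* Let $\Gamma$ be a singular Hamiltonian map on a commutative $H_T$-Leibniz algebra $V$, and let the operations $(f,g)\mapsto f_ng$, $n\in\mathbb Z$, on $V$ be defined by $\{f(\tau_1),g(\tau_2)\}=\Gamma(f)(g)=\sum_{n\in\mathbb Z}(f_ng)(\tau_2)T_2^n\delta(\tau_1,\tau_2)$. Then: (1) (Finiteness) for all $f,g\in V$, $f_ng=0$ for all but a finite number of $n\in\mathbb Z$; (2) ($H_T$-covariance) for all $f\in V$ and $n,p\in\mathbb Z$, $(T^pf)_n=f_{n+p}$; (3) (Skew-symmetry) for all $f,g\in V$ and $n\in\mathbb Z$, $f_ng=-T^n\langle g_{-n}f\rangle$; (4) (Commutator) for all $f,g\in V$ and $m,n\in\mathbb Z$, $[f_m,g_n]=(f_{m-n}g)_n$ as linear operators on $V$.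
   Context: $H_T=\mathbb C[T,T^{-1}]$ is the Hopf algebra with coproduct $T\mapsto T\otimes T$, counit $T\mapsto 1$, antipode $S(T)=T^{-1}$. A commutative $H_T$-Leibniz algebra $V$ is a commutative unital $\mathbb C$-algebra which is an $H_T$-module with $T$ acting by an algebra automorphism. $VH_T$ is the algebra of difference operators: finite sums $P=\sum_n p_nT^n$, $p_n\in V$, with $Tp=T\langle p\rangle T$, where $T\langle p\rangle$ denotes the action of $T$ on $p\in V$. The adjoint is $P^*=\sum_n T^{-n}p_n=\sum_nT^{-n}\langle p_n\rangle T^{-n}$. The module $V(\tau_1,\tau_2)$ of two-variable classical fields consists of expressions $Q_2\delta(\tau_1,\tau_2)=\sum_n q_n(\tau_2)T_2^n\delta(\tau_1,\tau_2)$ with unique $Q=\sum q_nT^n\in VH_T$; it has two commuting actions of $VH_T$: $P_2(Q_2\delta)=(PQ)_2\delta$ and $P_1(Q_2\delta)=(QP^* )_2\delta$ (so $P_1\delta=P_2^*\delta$). The module $V(\tau_1,\tau_2,\tau_3)$ of three-variable fields consists of finite sums $\sum_{n,p}v_{n,p}(\tau_3)T_1^{-n}T_2^{-p}\delta(\tau_1,\tau_2,\tau_3)$ with unique $v_{n,p}\in V$. A bilinear bracket $\{f(\tau_1),g(\tau_2)\}=\Gamma(f)(g)=\sum_n (f_ng)(\tau_2)T_2^n\delta(\tau_1,\tau_2)\in V(\tau_1,\tau_2)$, $f,g\in V$, is a singular Hamiltonian map if for all $f,g,k\in V$, $h\in H_T$: (a) $\Gamma(f)(gk)=g_2\Gamma(f)(k)+k_2\Gamma(f)(g)$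 and $\Gamma(f)(hg)=h_2\Gamma(f)(g)$; and $\Gamma(fk)(g)=f_1\Gamma(k)(g)+k_1\Gamma(f)(g)$, $\Gamma(hf)(g)=h_1\Gamma(f)(g)$; (b) $\{f(\tau_1),g(\tau_2)\}=-\{g(\tau_2),f(\tau_1)\}$, where $\{g(\tau_2),f(\tau_1)\}=\big(\sum_n(g_nf)T^n\big)_1\delta(\tau_1,\tau_2)$; (c) $\{f(\tau_1),\{g(\tau_2),k(\tau_3)\}\}=\{\{f(\tau_1),g(\tau_2)\},k(\tau_3)\}+\{g(\tau_2),\{f(\tau_1),k(\tau_3)\}\}$ in $V(\tau_1,\tau_2,\tau_3)$, where $\{f(\tau_1),\{g(\tau_2),k(\tau_3)\}\}=\sum_{n,p}f_n(g_pk)(\tau_3)T_1^{-n}T_2^{-p}\delta(\tau_1,\tau_2,\tau_3)$, $\{g(\tau_2),\{f(\tau_1),k(\tau_3)\}\}=\sum_{n,p}g_p(f_nk)(\tau_3)T_1^{-n}T_2^{-p}\delta(\tau_1,\tau_2,\tau_3)$, $\{\{f(\tau_1),g(\tau_2)\},k(\tau_3)\}=\sum_{q,r}((f_qg)_rk)(\tau_3)T_1^{-q-r}T_2^{-r}\delta(\tau_1,\tau_2,\tau_3)$. *)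

theory Defs
  imports Complex_Main "HOL-Library.Poly_Mapping"
begin

text \<open>
  The algebra \<open>H\<^sub>T = \<complex>[T, T\<^sup>-\<^sup>1]\<close> is the group algebra of the integers, i.e. the finitely
  supported functions from \<open>int\<close> to \<open>complex\<close> with the convolution product of
  \<^theory>\<open>HOL-Library.Poly_Mapping\<close>.
\<close>

type_synonym HT = "int \<Rightarrow>\<^sub>0 complex"

definition HT_T :: "int \<Rightarrow> HT" where
  "HT_T n = Poly_Mapping.single n 1"

text \<open>
  The sort \<open>{comm_ring, comm_monoid_mult}\<close> is that of commutative unital rings; unlike
  \<open>comm_ring_1\<close> it does not require \<open>0 \<noteq> 1\<close>, so the zero algebra is allowed.
\<close>

locale comm_complex_algebra = vector_space scale
  for scale :: "complex \<Rightarrow> 'a::{comm_ring, comm_monoid_mult} \<Rightarrow> 'a" +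
  assumes scale_mult_left: "scale c (x * y) = scale c x * y"

definition algebra_automorphism ::
    "(complex \<Rightarrow> 'a::{comm_ring, comm_monoid_mult} \<Rightarrow> 'a) \<Rightarrow> ('a \<Rightarrow> 'a) \<Rightarrow> bool" where
  "algebra_automorphism scale \<phi> \<longleftrightarrow>
     Vector_Spaces.linear scale scale \<phi> \<and> bij \<phi> \<and> \<phi> 1 = 1 \<and> (\<forall>x y. \<phi> (x * y) = \<phi> x * \<phi> y)"

text \<open>
  The assumption \<open>act_const\<close> says that the vector space structure underlying the \<open>H\<^sub>T\<close>-module \<open>V\<close>
  is the one of the algebra \<open>V\<close>.
\<close>

locale HT_Leibniz_algebra = comm_complex_algebra scale + HT: module act
  for scale :: "complex \<Rightarrow> 'a::{comm_ring, comm_monoid_mult} \<Rightarrow> 'a"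
    and act :: "HT \<Rightarrow> 'a \<Rightarrow> 'a" +
  assumes act_const: "act (Poly_Mapping.single 0 c) x = scale c x"
    and act_T_automorphism: "algebra_automorphism scale (act (HT_T 1))"

text \<open>
  Difference operators: the coefficient of \<open>P\<close> at \<open>n\<close> is the \<open>p\<^sub>n\<close> in \<open>P = \<Sum>\<^sub>n p\<^sub>n T\<^sup>n\<close>. The product
  is not the convolution product of \<open>(\<Rightarrow>\<^sub>0)\<close> but the twisted one determined by \<open>T p = T\<langle>p\<rangle> T\<close>,
  so that \<open>(p T\<^sup>m) (q T\<^sup>n) = p T\<^sup>m\<langle>q\<rangle> T\<^sup>m\<^sup>+\<^sup>n\<close>.
\<close>

type_synonym 'a diff_op = "int \<Rightarrow>\<^sub>0 'a"

definition dop_mult ::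
    "(HT \<Rightarrow> 'a \<Rightarrow> 'a) \<Rightarrow> 'a::{comm_ring, comm_monoid_mult} diff_op \<Rightarrow> 'a diff_op \<Rightarrow> 'a diff_op" where
  "dop_mult act P Q =
     (\<Sum>m\<in>Poly_Mapping.keys P. \<Sum>n\<in>Poly_Mapping.keys Q.
        Poly_Mapping.single (m + n)
          (Poly_Mapping.lookup P m * act (HT_T m) (Poly_Mapping.lookup Q n)))"

definition dop_adjoint ::
    "(HT \<Rightarrow> 'a \<Rightarrow> 'a) \<Rightarrow> 'a::{comm_ring, comm_monoid_mult} diff_op \<Rightarrow> 'a diff_op" where
  "dop_adjoint act P =
     (\<Sum>n\<in>Poly_Mapping.keys P.
        Poly_Mapping.single (- n) (act (HT_T (- n)) (Poly_Mapping.lookup P n)))"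

definition dop_scale ::
    "(complex \<Rightarrow> 'a \<Rightarrow> 'a) \<Rightarrow> complex \<Rightarrow> 'a::{comm_ring, comm_monoid_mult} diff_op \<Rightarrow> 'a diff_op" where
  "dop_scale scale c P = Poly_Mapping.map (scale c) P"

definition dop_of_V :: "'a::{comm_ring, comm_monoid_mult} \<Rightarrow> 'a diff_op" where
  "dop_of_V f = Poly_Mapping.single 0 f"

definition dop_of_HT ::
    "(complex \<Rightarrow> 'a \<Rightarrow> 'a) \<Rightarrow> HT \<Rightarrow> 'a::{comm_ring, comm_monoid_mult} diff_op" where
  "dop_of_HT scale h = Poly_Mapping.map (\<lambda>c. scale c 1) h"

text \<open>
  Two-variable fields: since every element of \<open>V(\<tau>\<^sub>1, \<tau>\<^sub>2)\<close> is \<open>Q\<^sub>2 \<delta>(\<tau>\<^sub>1, \<tau>\<^sub>2)\<close> for a unique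
  difference operator \<open>Q\<close>, it is represented by this \<open>Q\<close>; \<open>\<delta>\<close> itself is represented by \<open>1\<close>.
\<close>

type_synonym 'a field2 = "'a diff_op"

definition delta2 :: "'a::{comm_ring, comm_monoid_mult} field2" where
  "delta2 = Poly_Mapping.single 0 1"

definition act_fst ::
    "(HT \<Rightarrow> 'a \<Rightarrow> 'a) \<Rightarrow> 'a::{comm_ring, comm_monoid_mult} diff_op \<Rightarrow> 'a field2 \<Rightarrow> 'a field2" where
  "act_fst act P F = dop_mult act F (dop_adjoint act P)"

definition act_snd ::
    "(HT \<Rightarrow> 'a \<Rightarrow> 'a) \<Rightarrow> 'a::{comm_ring, comm_monoid_mult} diff_op \<Rightarrow> 'a field2 \<Rightarrow> 'a field2" where
  "act_snd act P F = dop_mult act P F"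

text \<open>
  Three-variable fields: the coefficient at \<open>(n, p)\<close> is the \<open>v\<^sub>n\<^sub>,\<^sub>p\<close> in
  \<open>\<Sum>\<^sub>n\<^sub>,\<^sub>p v\<^sub>n\<^sub>,\<^sub>p(\<tau>\<^sub>3) T\<^sub>1\<^sup>-\<^sup>n T\<^sub>2\<^sup>-\<^sup>p \<delta>(\<tau>\<^sub>1, \<tau>\<^sub>2, \<tau>\<^sub>3)\<close>.
\<close>

type_synonym 'a field3 = "int \<times> int \<Rightarrow>\<^sub>0 'a"

text \<open>
  \<open>nth_prod \<Gamma> f n g\<close> is \<open>f\<^sub>n g\<close>, the coefficient of \<open>T\<^sub>2\<^sup>n \<delta>\<close> in \<open>{f(\<tau>\<^sub>1), g(\<tau>\<^sub>2)}\<close>, so that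
  \<open>nth_prod \<Gamma> f n\<close> is the operator \<open>f\<^sub>n\<close> on \<open>V\<close>; \<open>modes \<Gamma> f g\<close> is the set of those \<open>n\<close> with
  \<open>f\<^sub>n g \<noteq> 0\<close>.
\<close>

definition nth_prod :: "('a \<Rightarrow> 'a \<Rightarrow> 'a::zero field2) \<Rightarrow> 'a \<Rightarrow> int \<Rightarrow> 'a \<Rightarrow> 'a" where
  "nth_prod \<Gamma> f n g = Poly_Mapping.lookup (\<Gamma> f g) n"

definition modes :: "('a \<Rightarrow> 'a \<Rightarrow> 'a::zero field2) \<Rightarrow> 'a \<Rightarrow> 'a \<Rightarrow> int set" where
  "modes \<Gamma> f g = Poly_Mapping.keys (\<Gamma> f g)"

text \<open>
  The brackets \<open>{f(\<tau>\<^sub>1), {g(\<tau>\<^sub>2), k(\<tau>\<^sub>3)}}\<close>, \<open>{g(\<tau>\<^sub>2), {f(\<tau>\<^sub>1), k(\<tau>\<^sub>3)}}\<close> and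
  \<open>{{f(\<tau>\<^sub>1), g(\<tau>\<^sub>2)}, k(\<tau>\<^sub>3)}\<close>, in this order.
\<close>

definition bracket_1_23 ::
    "('a \<Rightarrow> 'a \<Rightarrow> 'a field2) \<Rightarrow> 'a \<Rightarrow> 'a \<Rightarrow> 'a::{comm_ring, comm_monoid_mult} \<Rightarrow> 'a field3" where
  "bracket_1_23 \<Gamma> f g k =
     (\<Sum>p\<in>modes \<Gamma> g k. \<Sum>n\<in>modes \<Gamma> f (nth_prod \<Gamma> g p k).
        Poly_Mapping.single (n, p) (nth_prod \<Gamma> f n (nth_prod \<Gamma> g p k)))"

definition bracket_2_13 ::
    "('a \<Rightarrow> 'a \<Rightarrow> 'a field2) \<Rightarrow> 'a \<Rightarrow> 'a \<Rightarrow> 'a::{comm_ring, comm_monoid_mult} \<Rightarrow> 'a field3" where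
  "bracket_2_13 \<Gamma> f g k =
     (\<Sum>n\<in>modes \<Gamma> f k. \<Sum>p\<in>modes \<Gamma> g (nth_prod \<Gamma> f n k).
        Poly_Mapping.single (n, p) (nth_prod \<Gamma> g p (nth_prod \<Gamma> f n k)))"

definition bracket_12_3 ::
    "('a \<Rightarrow> 'a \<Rightarrow> 'a field2) \<Rightarrow> 'a \<Rightarrow> 'a \<Rightarrow> 'a::{comm_ring, comm_monoid_mult} \<Rightarrow> 'a field3" where
  "bracket_12_3 \<Gamma> f g k =
     (\<Sum>q\<in>modes \<Gamma> f g. \<Sum>r\<in>modes \<Gamma> (nth_prod \<Gamma> f q g) k.
        Poly_Mapping.single (q + r, r) (nth_prod \<Gamma> (nth_prod \<Gamma> f q g) r k))"

definition singular_Hamiltonian_map ::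
    "(complex \<Rightarrow> 'a \<Rightarrow> 'a) \<Rightarrow> (HT \<Rightarrow> 'a \<Rightarrow> 'a) \<Rightarrow>
     ('a \<Rightarrow> 'a \<Rightarrow> 'a::{comm_ring, comm_monoid_mult} field2) \<Rightarrow> bool" where
  "singular_Hamiltonian_map scale act \<Gamma> \<longleftrightarrow>
     (\<forall>f. Vector_Spaces.linear scale (dop_scale scale) (\<lambda>g. \<Gamma> f g)) \<and>
     (\<forall>g. Vector_Spaces.linear scale (dop_scale scale) (\<lambda>f. \<Gamma> f g)) \<and>
     (\<forall>f g k. \<Gamma> f (g * k) =
        act_snd act (dop_of_V g) (\<Gamma> f k) + act_snd act (dop_of_V k) (\<Gamma> f g)) \<and>
     (\<forall>f g h. \<Gamma> f (act h g) = act_snd act (dop_of_HT scale h) (\<Gamma> f g)) \<and>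
     (\<forall>f g k. \<Gamma> (f * k) g =
        act_fst act (dop_of_V f) (\<Gamma> k g) + act_fst act (dop_of_V k) (\<Gamma> f g)) \<and>
     (\<forall>f g h. \<Gamma> (act h f) g = act_fst act (dop_of_HT scale h) (\<Gamma> f g)) \<and>
     \<comment> \<open>\<open>\<Gamma> g f\<close> is read as the difference operator \<open>\<Sum>\<^sub>n (g\<^sub>n f) T\<^sup>n\<close>,
         which now acts on \<open>\<delta>(\<tau>\<^sub>1, \<tau>\<^sub>2)\<close> through the first variable\<close>
     (\<forall>f g. \<Gamma> f g = - act_fst act (\<Gamma> g f) delta2) \<and>
     (\<forall>f g k. bracket_1_23 \<Gamma> f g k = bracket_12_3 \<Gamma> f g k + bracket_2_13 \<Gamma> f g k)"

definition commutator :: "('a \<Rightarrow> 'a) \<Rightarrow> ('a \<Rightarrow> 'a) \<Rightarrow> 'a \<Rightarrow> 'a::group_add" where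
  "commutator A B = (\<lambda>x. A (B x) - B (A x))"

end

theory Submission
  imports Defs
begin

text \<open>
  Each claim is the comparison of coefficients in one of the axioms: covariance in
  \<open>\<Gamma>(T\<^sup>p f)(g) = \<Gamma>(f)(g) T\<^sup>-\<^sup>p\<close>, skew-symmetry in axiom (b), and the commutator formula at
  \<open>T\<^sub>1\<^sup>-\<^sup>m T\<^sub>2\<^sup>-\<^sup>n \<delta>\<close> in the Jacobi identity (c).
\<close>

lemma lookup_linear_zero:
  assumes "Vector_Spaces.linear s (dop_scale s') F"
  shows "Poly_Mapping.lookup (F 0) n = 0"
  using module_hom.zero[OF Vector_Spaces.linear.axioms(3)[OF assms]] by simp

context HT_Leibniz_algebra
begin

lemma act_T_zero [simp]: "act (HT_T 0) x = x"
  using HT.scale_one[of x] by (simp add: HT_T_def single_one)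

lemma act_T_add: "act (HT_T (m + n)) x = act (HT_T m) (act (HT_T n) x)"
  by (simp add: HT_T_def mult_single)

text \<open>Multiplicativity of the automorphism is not enough here: it fixes the unit, and this
  spreads to all powers of \<open>T\<close>. It makes the adjoint of \<open>T^p\<close> equal to
  \<open>T^(-p)\<close> with coefficient 1.\<close>

lemma act_T_unit [simp]: "act (HT_T n) 1 = 1"
proof -
  have T: "act (HT_T 1) 1 = 1"
    using act_T_automorphism by (simp add: algebra_automorphism_def)
  show ?thesis
  proof (induction n rule: int_induct[where k = 0])
    case base
    show ?case by simp
  next
    case (step1 i)
    then show ?case using T by (simp add: act_T_add)
  next
    case (step2 i)
    \<comment> \<open>Downward without inverting \<open>T\<close>: writing \<open>T^i\<close> as
      \<open>T^(i-1) T\<close> and using that \<open>T\<close> fixes 1, the powers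
      \<open>T^i\<close> and \<open>T^(i-1)\<close> agree on 1.\<close>
    then show ?case using act_T_add[of "i - 1" 1 1] T by simp
  qed
qed

text \<open>Only the term of \<open>P\<close> at \<open>-n\<close> reaches \<open>T^n\<close>. If
  \<open>-n\<close> is not a key, both sides vanish because the action sends 0 to 0.\<close>

lemma lookup_dop_adjoint:
  "Poly_Mapping.lookup (dop_adjoint act P) n = act (HT_T n) (Poly_Mapping.lookup P (- n))"
proof -
  have "Poly_Mapping.lookup (dop_adjoint act P) n =
      (\<Sum>i\<in>Poly_Mapping.keys P. if i = - n then act (HT_T n) (Poly_Mapping.lookup P (- n)) else 0)"
    unfolding dop_adjoint_def lookup_sum
    by (intro sum.cong) (auto simp: lookup_single when_def)
  then show ?thesis
    by (simp add: not_in_keys_iff_lookup_eq_zero)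
qed

lemma dop_adjoint_single:
  "dop_adjoint act (Poly_Mapping.single n p) = Poly_Mapping.single (- n) (act (HT_T (- n)) p)"
  by (rule poly_mapping_eqI) (auto simp: lookup_dop_adjoint lookup_single when_def)

text \<open>By the twisted product, \<open>p_i T^i\<close> times \<open>q T^k\<close> lands at
  \<open>i + k\<close>, so only \<open>i = n - k\<close> contributes.\<close>

lemma lookup_dop_mult_single:
  "Poly_Mapping.lookup (dop_mult act P (Poly_Mapping.single k q)) n =
     Poly_Mapping.lookup P (n - k) * act (HT_T (n - k)) q"
proof -
  have "Poly_Mapping.lookup (dop_mult act P (Poly_Mapping.single k q)) n =
      (\<Sum>i\<in>Poly_Mapping.keys P. if i = n - k
         then Poly_Mapping.lookup P (n - k) * act (HT_T (n - k)) q else 0)"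
    unfolding dop_mult_def lookup_sum
    by (intro sum.cong) (auto simp: lookup_single when_def)
  then show ?thesis
    by (simp add: not_in_keys_iff_lookup_eq_zero)
qed

text \<open>Needed to read \<open>P_1 delta\<close> as the adjoint of \<open>P\<close>. The zero
  algebra is split off because there \<open>delta2\<close> has no keys; all its elements coincide,
  so the claim is trivial.\<close>

lemma dop_mult_delta2: "dop_mult act delta2 P = P"
proof (cases "(1 :: 'a) = 0")
  case True
  then have "x = 0" for x :: 'a
    by (metis mult_1 mult_zero_left)
  then show ?thesis
    by (intro poly_mapping_eqI) metis
next
  case False
  show ?thesis
  proof (rule poly_mapping_eqI)
    fix k
    have keys: "Poly_Mapping.keys (delta2 :: 'a field2) = {0}"
      and one: "Poly_Mapping.lookup (delta2 :: 'a field2) 0 = 1"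
      using False by (simp_all add: delta2_def)
    have "Poly_Mapping.lookup (dop_mult act delta2 P) k =
        (\<Sum>n\<in>Poly_Mapping.keys P. if n = k then Poly_Mapping.lookup P k else 0)"
      by (auto simp: dop_mult_def keys one lookup_sum lookup_single when_def intro: sum.cong)
    then show "Poly_Mapping.lookup (dop_mult act delta2 P) k = Poly_Mapping.lookup P k"
      by (simp add: not_in_keys_iff_lookup_eq_zero)
  qed
qed

lemma dop_of_HT_T: "dop_of_HT scale (HT_T p) = Poly_Mapping.single p 1"
  by (rule poly_mapping_eqI)
    (simp add: dop_of_HT_def HT_T_def map.rep_eq lookup_single when_def)

end

text \<open>An index outside \<open>modes\<close> makes the sum empty of its only possible term; the
  hypothesis says that this term is then 0 anyway.\<close>

lemma sum_modes_delta:
  assumes "nth_prod \<Gamma> f n g = 0 \<Longrightarrow> c = 0"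
  shows "(\<Sum>i\<in>modes \<Gamma> f g. if i = n then c else 0) = c"
  using assms
  by (cases "n \<in> modes \<Gamma> f g")
    (simp_all add: modes_def nth_prod_def not_in_keys_iff_lookup_eq_zero)

text \<open>The inner sum collapses first, since its index is tested outermost. Collapsing the outer
  one needs the second-argument zero law, for the case that \<open>g_n k\<close> is 0.\<close>

lemma lookup_bracket_1_23:
  assumes "\<And>x n. nth_prod \<Gamma> x n 0 = 0"
  shows "Poly_Mapping.lookup (bracket_1_23 \<Gamma> f g k) (m, n) =
    nth_prod \<Gamma> f m (nth_prod \<Gamma> g n k)"
proof -
  have "Poly_Mapping.lookup (bracket_1_23 \<Gamma> f g k) (m, n) =
      (\<Sum>p\<in>modes \<Gamma> g k. \<Sum>i\<in>modes \<Gamma> f (nth_prod \<Gamma> g p k).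
         if i = m then if p = n then nth_prod \<Gamma> f m (nth_prod \<Gamma> g n k) else 0 else 0)"
    unfolding bracket_1_23_def lookup_sum
    by (intro sum.cong refl) (auto simp: lookup_single when_def)
  also have "\<dots> = (\<Sum>p\<in>modes \<Gamma> g k. if p = n then nth_prod \<Gamma> f m (nth_prod \<Gamma> g n k) else 0)"
    by (intro sum.cong refl sum_modes_delta) auto
  also have "\<dots> = nth_prod \<Gamma> f m (nth_prod \<Gamma> g n k)"
    by (intro sum_modes_delta) (simp add: assms)
  finally show ?thesis .
qed

lemma lookup_bracket_2_13:
  assumes "\<And>x n. nth_prod \<Gamma> x n 0 = 0"
  shows "Poly_Mapping.lookup (bracket_2_13 \<Gamma> f g k) (m, n) =
    nth_prod \<Gamma> g n (nth_prod \<Gamma> f m k)"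
proof -
  have "Poly_Mapping.lookup (bracket_2_13 \<Gamma> f g k) (m, n) =
      (\<Sum>p\<in>modes \<Gamma> f k. \<Sum>i\<in>modes \<Gamma> g (nth_prod \<Gamma> f p k).
         if i = n then if p = m then nth_prod \<Gamma> g n (nth_prod \<Gamma> f m k) else 0 else 0)"
    unfolding bracket_2_13_def lookup_sum
    by (intro sum.cong refl) (auto simp: lookup_single when_def)
  also have "\<dots> = (\<Sum>p\<in>modes \<Gamma> f k. if p = m then nth_prod \<Gamma> g n (nth_prod \<Gamma> f m k) else 0)"
    by (intro sum.cong refl sum_modes_delta) auto
  also have "\<dots> = nth_prod \<Gamma> g n (nth_prod \<Gamma> f m k)"
    by (intro sum_modes_delta) (simp add: assms)
  finally show ?thesis .
qed

text \<open>Solving \<open>(q + r, r) = (m, n)\<close> gives \<open>r = n\<close> and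
  \<open>q = m - n\<close>, the source of the index shift in the commutator formula. The vanishing
  element \<open>f_(m-n) g\<close> now sits in the first argument, so the zero law is required
  there.\<close>

lemma lookup_bracket_12_3:
  assumes "\<And>x n. nth_prod \<Gamma> 0 n x = 0"
  shows "Poly_Mapping.lookup (bracket_12_3 \<Gamma> f g k) (m, n) =
    nth_prod \<Gamma> (nth_prod \<Gamma> f (m - n) g) n k"
proof -
  have "Poly_Mapping.lookup (bracket_12_3 \<Gamma> f g k) (m, n) =
      (\<Sum>p\<in>modes \<Gamma> f g. \<Sum>i\<in>modes \<Gamma> (nth_prod \<Gamma> f p g) k.
         if i = n then if p = m - n then nth_prod \<Gamma> (nth_prod \<Gamma> f (m - n) g) n k else 0 else 0)"
    unfolding bracket_12_3_def lookup_sum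
    by (intro sum.cong refl) (auto simp: lookup_single when_def)
  also have "\<dots> = (\<Sum>p\<in>modes \<Gamma> f g. if p = m - n then nth_prod \<Gamma> (nth_prod \<Gamma> f (m - n) g) n k else 0)"
    by (intro sum.cong refl sum_modes_delta) auto
  also have "\<dots> = nth_prod \<Gamma> (nth_prod \<Gamma> f (m - n) g) n k"
    by (intro sum_modes_delta) (simp add: assms)
  finally show ?thesis .
qed

theorem lemma2p1:
  fixes scale :: "complex \<Rightarrow> 'a::{comm_ring, comm_monoid_mult} \<Rightarrow> 'a"
    and act :: "HT \<Rightarrow> 'a \<Rightarrow> 'a"
    and \<Gamma> :: "'a \<Rightarrow> 'a \<Rightarrow> 'a field2"
  assumes "HT_Leibniz_algebra scale act"
    and "singular_Hamiltonian_map scale act \<Gamma>"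
  shows "(\<forall>f g. finite {n. nth_prod \<Gamma> f n g \<noteq> 0}) \<and>
    (\<forall>f n p. nth_prod \<Gamma> (act (HT_T p) f) n = nth_prod \<Gamma> f (n + p)) \<and>
    (\<forall>f g n. nth_prod \<Gamma> f n g = - act (HT_T n) (nth_prod \<Gamma> g (- n) f)) \<and>
    (\<forall>f g m n. commutator (nth_prod \<Gamma> f m) (nth_prod \<Gamma> g n) =
       nth_prod \<Gamma> (nth_prod \<Gamma> f (m - n) g) n)"
proof -
  interpret HT_Leibniz_algebra scale act
    by (rule assms(1))
  have lin2: "Vector_Spaces.linear scale (dop_scale scale) (\<lambda>g. \<Gamma> f g)"
    and lin1: "Vector_Spaces.linear scale (dop_scale scale) (\<lambda>f. \<Gamma> f g)"
    and cov: "\<Gamma> (act h f) g = act_fst act (dop_of_HT scale h) (\<Gamma> f g)"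
    and skew: "\<Gamma> f g = - act_fst act (\<Gamma> g f) delta2"
    and jacobi: "bracket_1_23 \<Gamma> f g k = bracket_12_3 \<Gamma> f g k + bracket_2_13 \<Gamma> f g k"
    for f g k h
    using assms(2) unfolding singular_Hamiltonian_map_def by blast+
  have zero2: "nth_prod \<Gamma> x n 0 = 0" and zero1: "nth_prod \<Gamma> 0 n x = 0" for x n
    using lookup_linear_zero[OF lin2] lookup_linear_zero[OF lin1]
    by (simp_all add: nth_prod_def)
  have "finite {n. nth_prod \<Gamma> f n g \<noteq> 0}" for f g
    \<comment> \<open>Finiteness is built into the representation of fields by finitely supported
      functions.\<close>
    by (simp add: nth_prod_def)
  moreover have "nth_prod \<Gamma> (act (HT_T p) f) n = nth_prod \<Gamma> f (n + p)" for f n p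
    \<comment> \<open>Right multiplication by \<open>T^(-p)\<close> moves the coefficient at
      \<open>n + p\<close> to \<open>n\<close>, and its factor is \<open>T^(n+p)\<close> applied to
      1, hence 1.\<close>
    by (rule ext)
      (simp add: nth_prod_def cov act_fst_def dop_of_HT_T dop_adjoint_single lookup_dop_mult_single)
  moreover have "nth_prod \<Gamma> f n g = - act (HT_T n) (nth_prod \<Gamma> g (- n) f)" for f g n
    unfolding nth_prod_def
    by (subst skew) (simp add: act_fst_def dop_mult_delta2 lookup_dop_adjoint)
  moreover have "commutator (nth_prod \<Gamma> f m) (nth_prod \<Gamma> g n) =
      nth_prod \<Gamma> (nth_prod \<Gamma> f (m - n) g) n" for f g m n
  proof
    fix k
    show "commutator (nth_prod \<Gamma> f m) (nth_prod \<Gamma> g n) k =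
        nth_prod \<Gamma> (nth_prod \<Gamma> f (m - n) g) n k"
      using arg_cong[OF jacobi[of f g k], of "\<lambda>F. Poly_Mapping.lookup F (m, n)"]
      by (simp add: commutator_def lookup_add lookup_bracket_1_23[OF zero2]
          lookup_bracket_2_13[OF zero2] lookup_bracket_12_3[OF zero1])
  qed
  ultimately show ?thesis
    by blast
qed

end
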